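(* Let $k\ge 3$ and $1 \le t\le 2^{\lceil \log_2 k\rceil}$ be integers. Then $f_k(n,t)=O(\log\log n)$.
   Context: Let $[n]=\{1,\dots,n\}$. A permutation $\rho$ of a finite set $X$ is a total order $<_\rho$ of the elements of $X$; if $Y\subseteq X$, then $\rho$ induces a permutation on $Y$ by restricting the order. For $t\ge 1$, a family $\mathcal{P}$ of permutations of $[n]$ $t$-shatters a set $X\subseteq[n]$ if the permutations of $\mathcal{P}$ induce at least $t$ distinct permutations on $X$. For $n \ge k$, $f_k(n,t)$ denotes the minimum number of permutations in a family of permutations of $[n]$ that $t$-shatters every subset of $[n]$ of size $k$. Asymptotic notation is for $k$ and $t$ fixed and $n\to\infty$; the implied constants may depend on $k$ and $t$. *)

theory Defs
  imports Complex_Main "HOL-Library.Landau_Symbols"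
begin

(* A permutation of X is a total order of X, given as the corresponding reflexive relation
   r \<subseteq> X \<times> X; the order it induces on Y is r \<inter> Y \<times> Y. *)

definition perms_of :: "'a set \<Rightarrow> ('a \<times> 'a) set set" where
  "perms_of X = {r. linear_order_on X r}"

definition induced :: "'a set \<Rightarrow> ('a \<times> 'a) set \<Rightarrow> ('a \<times> 'a) set" where
  "induced Y r = r \<inter> Y \<times> Y"

definition t_shatters :: "nat \<Rightarrow> ('a \<times> 'a) set set \<Rightarrow> 'a set \<Rightarrow> bool" where
  "t_shatters t P X \<longleftrightarrow> t \<le> card (induced X ` P)"

definition shattering_family :: "nat \<Rightarrow> nat \<Rightarrow> nat \<Rightarrow> (nat \<times> nat) set set \<Rightarrow> bool" where
  "shattering_family k n t P \<longleftrightarrow>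
     P \<subseteq> perms_of {1..n} \<and> (\<forall>X. X \<subseteq> {1..n} \<and> card X = k \<longrightarrow> t_shatters t P X)"

(* Families are finite, since perms_of {1..n} is. For n \<ge> k and t \<le> fact k the minimum exists,
   because perms_of {1..n} itself is a shattering family. *)

definition f_min :: "nat \<Rightarrow> nat \<Rightarrow> nat \<Rightarrow> nat" where
  "f_min k n t = (LEAST m. \<exists>P. shattering_family k n t P \<and> card P = m)"

end

theory Submission
  imports Defs "HOL-Real_Asymp.Real_Asymp"
begin

text \<open>
  Identify the ground set with binary strings of length \<open>d \<approx> log 2 n\<close>, and order it
  lexicographically, except that the roles of 0 and 1 are exchanged on a chosen set of levels.
  On numbers this is the order of the values \<open>xor x a\<close>, where the mask \<open>a\<close> is 1 on the chosen
  levels. If \<open>i\<close> is the highest level on which \<open>x\<close> and \<open>y\<close> differ, then bit \<open>i\<close> of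
  \<open>a\<close> alone decides how they are ordered.

  Call the levels arising in this way from pairs in a set \<open>X\<close> the split levels of \<open>X\<close>: they are
  the levels at which the binary tree spanned by \<open>X\<close> branches. Masks that disagree on some
  split level order \<open>X\<close> differently (\<open>flip_order_differ\<close>). The bits on the split levels determine
  an element of \<open>X\<close>, so a set of size \<open>k\<close> has at least \<open>m = \<lceil>log 2 k\<rceil>\<close> split levels
  (\<open>card_le_power_split_levels\<close>). Hence a family of masks realising all \<open>2 ^ m\<close> patterns on every
  \<open>m\<close>-subset of the \<open>d\<close> levels yields \<open>2 ^ m\<close> orders on every \<open>k\<close>-set.

  Such a family needs only \<open>O(log d) = O(log log n)\<close> masks
  (\<open>exists_small_universal_family\<close>): there are at most \<open>(2 * d) ^ m\<close> patterns, each is realised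
  by a fraction \<open>1 / 2 ^ m\<close> of all masks, and so a greedily chosen mask realises at least this
  fraction of the patterns that are still missing.
\<close>

section \<open>Lexicographic orders with flipped levels\<close>

definition flip_order :: "nat set \<Rightarrow> nat \<Rightarrow> (nat \<times> nat) set" where
  "flip_order X a = {(x, y) \<in> X \<times> X. xor x a \<le> xor y a}"

definition split_at :: "nat \<Rightarrow> nat \<Rightarrow> nat \<Rightarrow> bool" where
  "split_at i x y \<longleftrightarrow> bit x i \<noteq> bit y i \<and> (\<forall>j>i. bit x j = bit y j)"

text \<open>
  These are the levels of the branching nodes of the binary tree whose leaves are the elements
  of \<open>X\<close>; several branching nodes may share a level.
\<close>
definition split_levels :: "nat set \<Rightarrow> nat set" where
  "split_levels X = {i. \<exists>x\<in>X. \<exists>y\<in>X. split_at i x y}"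

lemma inj_xor: "xor x a = xor y a \<longleftrightarrow> x = (y :: nat)"
  by (metis xor.assoc xor.right_neutral xor_self_eq)

lemma flip_order_in_perms_of: "flip_order X a \<in> perms_of X"
  unfolding perms_of_def flip_order_def linear_order_on_def partial_order_on_def preorder_on_def
  by (auto simp: refl_on_def trans_def antisym_def total_on_def inj_xor)

lemma induced_flip_order: "Y \<subseteq> X \<Longrightarrow> induced Y (flip_order X a) = flip_order Y a"
  by (auto simp: induced_def flip_order_def)

lemma not_bit_of_less_power:
  fixes x :: nat
  assumes "x < 2 ^ d" "d \<le> i"
  shows "\<not> bit x i"
proof -
  have "x < 2 ^ i"
    using assms by (meson less_le_trans one_le_numeral power_increasing)
  then show ?thesis
    by (simp add: bit_iff_odd)
qed

text \<open>
  Above level \<open>i\<close> the two numbers agree, so dividing by \<open>2 ^ i\<close> turns them into \<open>2 * q\<close> and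
  \<open>2 * q + 1\<close> with the same \<open>q\<close>.
\<close>
lemma less_if_split_at:
  assumes "split_at i x y" "bit y i"
  shows "x < y"
proof -
  have "drop_bit (Suc i) x = drop_bit (Suc i) y"
    using assms by (intro bit_eqI) (auto simp: split_at_def bit_drop_bit_eq)
  then have high: "x div 2 ^ i div 2 = y div 2 ^ i div 2"
    by (simp only: drop_bit_eq_div power_Suc2 div_mult2_eq)
  have "even (x div 2 ^ i)" "odd (y div 2 ^ i)"
    using assms by (auto simp: split_at_def bit_iff_odd)
  then have "x div 2 ^ i = 2 * (x div 2 ^ i div 2)" "y div 2 ^ i = 2 * (y div 2 ^ i div 2) + 1"
    using even_two_times_div_two[of "x div 2 ^ i"] odd_two_times_div_two_succ[of "y div 2 ^ i"]
    by (simp_all only: simp_thms)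
  with high have "x div 2 ^ i < y div 2 ^ i"
    by linarith
  then show ?thesis
    by (meson div_le_mono leD leI)
qed

lemma split_at_sym: "split_at i x y \<Longrightarrow> split_at i y x"
  by (auto simp: split_at_def)

lemma le_iff_bit_if_split_at:
  assumes "split_at i x y"
  shows "x \<le> y \<longleftrightarrow> bit y i"
proof (cases "bit y i")
  case True
  then show ?thesis
    using less_if_split_at[OF assms] by simp
next
  case False
  then have "y < x"
    using less_if_split_at[OF split_at_sym[OF assms]] assms by (auto simp: split_at_def)
  with False show ?thesis
    by simp
qed

lemma split_at_xor: "split_at i x y \<Longrightarrow> split_at i (xor x a) (xor y a)"
  by (auto simp: split_at_def bit_xor_iff)

text \<open>
  A pair that splits at level \<open>i\<close> still splits there after any mask has been applied, so its order
  is read off from bit \<open>i\<close> of the mask.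
\<close>
lemma flip_order_differ:
  assumes "i \<in> split_levels X" "bit a i \<noteq> bit b i"
  shows "flip_order X a \<noteq> flip_order X b"
proof -
  obtain x y where xy: "x \<in> X" "y \<in> X" "split_at i x y"
    using assms(1) by (auto simp: split_levels_def)
  have "(x, y) \<in> flip_order X c \<longleftrightarrow> bit y i \<noteq> bit c i" for c
    using xy le_iff_bit_if_split_at[OF split_at_xor[OF xy(3)], of c]
    by (simp add: flip_order_def bit_xor_iff)
  then show ?thesis
    using assms(2) by blast
qed

section \<open>The number of split levels\<close>

lemma split_at_exists:
  fixes x y :: nat
  assumes "x \<noteq> y"
  shows "\<exists>i. split_at i x y"
proof -
  let ?D = "{i. bit x i \<noteq> bit y i}"
  \<comment> \<open>The bound only serves to make the maximum of \<open>?D\<close> exist.\<close>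
  have "?D \<subseteq> {..<x + y}"
  proof
    fix i assume "i \<in> ?D"
    moreover have "x < 2 ^ (x + y)" "y < 2 ^ (x + y)"
      by (meson le_add1 le_add2 le_less_trans less_exp)+
    ultimately have "\<not> x + y \<le> i"
      using not_bit_of_less_power by blast
    then show "i \<in> {..<x + y}"
      by simp
  qed
  then have fin: "finite ?D"
    using finite_subset by blast
  moreover have "?D \<noteq> {}"
    using assms by (auto intro: bit_eqI)
  ultimately have "Max ?D \<in> ?D"
    by (rule Max_in)
  moreover have "bit x j = bit y j" if "Max ?D < j" for j
    using that Max_ge[OF fin, of j] by fastforce
  ultimately have "split_at (Max ?D) x y"
    unfolding split_at_def by blast
  then show ?thesis ..
qed

lemma split_levels_bounded:
  assumes "X \<subseteq> {..<2 ^ d}"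
  shows "split_levels X \<subseteq> {..<d}"
proof
  fix i assume "i \<in> split_levels X"
  then obtain x y where "x \<in> X" "y \<in> X" "bit x i \<noteq> bit y i"
    by (auto simp: split_levels_def split_at_def)
  moreover from this have "x < 2 ^ d" "y < 2 ^ d"
    using assms by auto
  ultimately have "\<not> d \<le> i"
    using not_bit_of_less_power by blast
  then show "i \<in> {..<d}"
    by simp
qed

text \<open>
  Two distinct elements differ on the level at which they split, so an element of \<open>X\<close> is determined
  by its bits on the split levels. For trees: a binary tree whose branching nodes occupy
  \<open>l\<close> levels has at most \<open>2 ^ l\<close> leaves.
\<close>
lemma card_le_power_split_levels:
  assumes "X \<subseteq> {..<2 ^ d}"
  shows "card X \<le> 2 ^ card (split_levels X)"
proof -
  let ?L = "split_levels X"
  have fin: "finite ?L"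
    using split_levels_bounded[OF assms] finite_subset by blast
  have "inj_on (\<lambda>x. {i \<in> ?L. bit x i}) X"
  proof (rule inj_onI, rule ccontr)
    fix x y
    assume xy: "x \<in> X" "y \<in> X" "x \<noteq> y" and eq: "{i \<in> ?L. bit x i} = {i \<in> ?L. bit y i}"
    then obtain i where "split_at i x y"
      using split_at_exists by blast
    then have "i \<in> ?L" "bit x i \<noteq> bit y i"
      using xy by (auto simp: split_levels_def split_at_def)
    with eq show False
      by blast
  qed
  then have "card X \<le> card (Pow ?L)"
    using fin by (intro card_inj_on_le) auto
  then show ?thesis
    using fin by (simp add: card_Pow)
qed

lemma exists_bits_eq:
  assumes "finite F"
  shows "\<exists>a :: nat. \<forall>i. bit a i \<longleftrightarrow> i \<in> F"
  using assms
proof (induction F rule: finite_induct)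
  case empty
  then show ?case
    by (intro exI[of _ 0]) simp
next
  case (insert j F)
  then obtain a :: nat where "\<forall>i. bit a i \<longleftrightarrow> i \<in> F"
    by blast
  then show ?case
    by (intro exI[of _ "set_bit j a"]) (auto simp: bit_set_bit_iff)
qed

section \<open>Orders from a universal family of masks\<close>

text \<open>
  Families with this property are known as \<open>m\<close>-universal or \<open>m\<close>-independent: every \<open>m\<close>-subset of
  the ground set is shattered in the sense of Vapnik and Chervonenkis.
\<close>
definition hits_all_traces :: "nat \<Rightarrow> 'a set \<Rightarrow> 'a set set \<Rightarrow> bool" where
  "hits_all_traces m D \<F> \<longleftrightarrow> (\<forall>S A. S \<subseteq> D \<longrightarrow> card S = m \<longrightarrow> A \<subseteq> S \<longrightarrow> (\<exists>F\<in>\<F>. F \<inter> S = A))"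

text \<open>
  Among the split levels pick \<open>m\<close>. Choosing for each of their subsets a member of the family with
  this trace gives \<open>2 ^ m\<close> masks that pairwise disagree on a split level.
\<close>
lemma flip_orders_of_universal_family:
  assumes X: "X \<subseteq> {..<2 ^ d}" and m: "m \<le> card (split_levels X)"
    and \<F>: "hits_all_traces m {..<d} \<F>" "finite \<F>"
    and code: "\<And>F i. F \<in> \<F> \<Longrightarrow> bit (code F) i \<longleftrightarrow> i \<in> F"
  shows "2 ^ m \<le> card ((\<lambda>F. flip_order X (code F)) ` \<F>)"
proof -
  obtain S where S: "S \<subseteq> split_levels X" "card S = m" "finite S"
    using obtain_subset_with_card_n[OF m] by blast
  have "\<forall>A\<in>Pow S. \<exists>F\<in>\<F>. F \<inter> S = A"
    using \<F>(1) S split_levels_bounded[OF X] unfolding hits_all_traces_def by blast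
  then obtain G where G: "\<And>A. A \<subseteq> S \<Longrightarrow> G A \<in> \<F> \<and> G A \<inter> S = A"
    by (metis PowI)
  have "inj_on (\<lambda>A. flip_order X (code (G A))) (Pow S)"
  proof (rule inj_onI, rule ccontr)
    fix A B
    assume AB: "A \<in> Pow S" "B \<in> Pow S" "A \<noteq> B"
      and eq: "flip_order X (code (G A)) = flip_order X (code (G B))"
    then obtain i where "i \<in> S" "i \<in> A \<longleftrightarrow> i \<notin> B"
      by blast
    then have "i \<in> split_levels X" "bit (code (G A)) i \<noteq> bit (code (G B)) i"
      using S AB G[of A] G[of B] code by blast+
    with eq show False
      using flip_order_differ by blast
  qed
  then have "card (Pow S) \<le> card ((\<lambda>F. flip_order X (code F)) ` \<F>)"
    using G \<F>(2) by (intro card_inj_on_le) auto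
  then show ?thesis
    using S by (simp add: card_Pow)
qed

section \<open>Small universal families\<close>

text \<open>
  Averaging: count the pairs \<open>(x, u)\<close> with \<open>R x u\<close> in both ways.
\<close>
lemma exists_popular_element:
  fixes p :: real
  assumes "finite D" "finite U" "D \<noteq> {}"
    and popular: "\<And>u. u \<in> U \<Longrightarrow> p * card D \<le> card {x \<in> D. R x u}"
  shows "\<exists>x\<in>D. p * card U \<le> card {u \<in> U. R x u}"
proof (rule ccontr)
  assume "\<not> ?thesis"
  then have "(\<Sum>x\<in>D. real (card {u \<in> U. R x u})) < (\<Sum>x\<in>D. p * card U)"
    using assms(1,3) by (intro sum_strict_mono) auto
  moreover have "(\<Sum>u\<in>U. p * card D) \<le> (\<Sum>u\<in>U. real (card {x \<in> D. R x u}))"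
    using popular by (intro sum_mono)
  moreover have "(\<Sum>x\<in>D. card {u \<in> U. R x u}) = (\<Sum>u\<in>U. card {x \<in> D. R x u})"
    using sum.swap_restrict[OF assms(1,2), of "\<lambda>_ _. 1::nat" R] by simp
  then have "(\<Sum>x\<in>D. real (card {u \<in> U. R x u})) = (\<Sum>u\<in>U. real (card {x \<in> D. R x u}))"
    by (simp flip: of_nat_sum)
  moreover have "(\<Sum>x\<in>D. p * real (card U)) = (\<Sum>u\<in>U. p * real (card D))"
    by simp
  ultimately show False
    by linarith
qed

text \<open>
  Read \<open>R x u\<close> as saying that \<open>x\<close> satisfies the constraint \<open>u\<close>. The averaging argument applies again to the
  constraints that are left over, since it is a condition on each single constraint. So each further
  element shrinks the set of unsatisfied constraints by the factor \<open>1 - p\<close>.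
\<close>
lemma greedy_cover:
  fixes p :: real
  assumes "finite D" "finite U" "D \<noteq> {}" "p \<le> 1"
    and popular: "\<And>u. u \<in> U \<Longrightarrow> p * card D \<le> card {x \<in> D. R x u}"
  shows "\<exists>E\<subseteq>D. card E \<le> N \<and> card {u \<in> U. \<forall>x\<in>E. \<not> R x u} \<le> (1 - p) ^ N * card U"
proof (induction N)
  case 0
  then show ?case
    by (intro exI[of _ "{}"]) auto
next
  case (Suc N)
  then obtain E where E: "E \<subseteq> D" "card E \<le> N"
    "card {u \<in> U. \<forall>x\<in>E. \<not> R x u} \<le> (1 - p) ^ N * card U"
    by blast
  define V where "V = {u \<in> U. \<forall>x\<in>E. \<not> R x u}"
  have V: "finite V" "V \<subseteq> U"
    using assms(2) by (auto simp: V_def)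
  then obtain x where x: "x \<in> D" "p * card V \<le> card {u \<in> V. R x u}"
    using exists_popular_element[OF assms(1) V(1) assms(3), of p R] popular by blast
  have "{u \<in> U. \<forall>y\<in>insert x E. \<not> R y u} = V - {u \<in> V. R x u}"
    by (auto simp: V_def)
  then have "real (card {u \<in> U. \<forall>y\<in>insert x E. \<not> R y u}) = card V - real (card {u \<in> V. R x u})"
    using V by (simp add: card_Diff_subset card_mono of_nat_diff)
  also have "\<dots> \<le> (1 - p) * card V"
    using x(2) by (simp add: algebra_simps)
  also have "\<dots> \<le> (1 - p) * ((1 - p) ^ N * card U)"
    using E(3) assms(4) by (intro mult_left_mono) (auto simp: V_def)
  finally have "real (card {u \<in> U. \<forall>y\<in>insert x E. \<not> R y u}) \<le> (1 - p) ^ Suc N * card U"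
    by (simp add: mult.assoc)
  moreover have "card (insert x E) \<le> Suc N"
    using E(2) card_insert_le_m1[of "Suc N" E x] by simp
  ultimately show ?case
    using E(1) x(1) by (intro exI[of _ "insert x E"]) auto
qed

lemma card_subsets_with_trace:
  assumes "finite D" "S \<subseteq> D" "A \<subseteq> S"
  shows "2 ^ card D \<le> 2 ^ card S * card {F \<in> Pow D. F \<inter> S = A}"
proof -
  \<comment> \<open>Outside \<open>S\<close> the set \<open>F\<close> is arbitrary.\<close>
  have "card (Pow (D - S)) \<le> card {F \<in> Pow D. F \<inter> S = A}"
  proof (rule card_inj_on_le)
    show "inj_on (\<lambda>B. A \<union> B) (Pow (D - S))"
      using assms by (auto intro!: inj_onI)
    show "(\<lambda>B. A \<union> B) ` Pow (D - S) \<subseteq> {F \<in> Pow D. F \<inter> S = A}"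
      using assms by auto
    show "finite {F \<in> Pow D. F \<inter> S = A}"
      using assms by simp
  qed
  moreover have "card D = card S + card (D - S)"
    using assms by (metis card_Diff_subset card_mono finite_subset le_add_diff_inverse)
  ultimately show ?thesis
    using assms by (simp add: card_Pow power_add)
qed

lemma card_traces_le:
  "card (SIGMA S:{S. S \<subseteq> {..<d} \<and> card S = m}. Pow S) \<le> (2 * d) ^ m"
proof -
  have fin: "finite {S. S \<subseteq> {..<d} \<and> card S = m}"
    by (rule finite_subset[of _ "Pow {..<d}"]) auto
  have "card (SIGMA S:{S. S \<subseteq> {..<d} \<and> card S = m}. Pow S)
      = (\<Sum>S\<in>{S. S \<subseteq> {..<d} \<and> card S = m}. card (Pow S))"
    using fin by (intro card_SigmaI) (auto intro: finite_subset)
  also have "\<dots> = (\<Sum>S\<in>{S. S \<subseteq> {..<d} \<and> card S = m}. 2 ^ m)"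
    by (intro sum.cong) (auto simp: card_Pow finite_subset)
  also have "\<dots> = (d choose m) * 2 ^ m"
    using n_subsets[of "{..<d}" m] by simp
  also have "\<dots> \<le> d ^ m * 2 ^ m"
    by (cases "m \<le> d") (auto simp: binomial_le_pow binomial_eq_0)
  finally show ?thesis
    by (simp add: power_mult_distrib mult.commute)
qed

text \<open>
  The constraints are the pairs \<open>(S, A)\<close> of an \<open>m\<close>-set \<open>S\<close> and a trace \<open>A\<close> on it. At most
  \<open>(2 * d) ^ m\<close> constraints exist, and after \<open>N > 2 ^ m * ln ((2 * d) ^ m)\<close> greedy steps fewer than
  one of them is left.
\<close>
lemma exists_small_universal_family:
  assumes "d > 0"
  shows "\<exists>\<F>\<subseteq>Pow {..<d}. hits_all_traces m {..<d} \<F>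
           \<and> real (card \<F>) \<le> 2 ^ m * real m * ln (2 * real d) + 2"
proof -
  define U where "U = (SIGMA S:{S. S \<subseteq> {..<d} \<and> card S = m}. Pow S)"
  define R where "R = (\<lambda>F :: nat set. \<lambda>(S, A). F \<inter> S = A)"
  define p :: real where "p = 1 / 2 ^ m"
  define N where "N = Suc (nat \<lceil>2 ^ m * real m * ln (2 * real d)\<rceil>)"
  have p: "0 < p" "p \<le> 1"
    by (auto simp: p_def)
  have "finite U"
    unfolding U_def
    by (rule finite_subset[of _ "Pow {..<d} \<times> Pow {..<d}"]) auto
  moreover have "p * card (Pow {..<d}) \<le> card {F \<in> Pow {..<d}. R F u}" if u_in: "u \<in> U" for u
  proof -
    obtain S A where u: "u = (S, A)" "S \<subseteq> {..<d}" "card S = m" "A \<subseteq> S"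
      using u_in by (auto simp: U_def)
    have "2 ^ d \<le> 2 ^ m * card {F \<in> Pow {..<d}. F \<inter> S = A}"
      using card_subsets_with_trace[of "{..<d}" S A] u by simp
    then have "real (2 ^ d) \<le> real (2 ^ m * card {F \<in> Pow {..<d}. F \<inter> S = A})"
      using of_nat_mono by blast
    then show ?thesis
      by (simp add: u R_def p_def card_Pow field_simps)
  qed
  ultimately obtain \<F> where \<F>: "\<F> \<subseteq> Pow {..<d}" "card \<F> \<le> N"
    "real (card {u \<in> U. \<forall>F\<in>\<F>. \<not> R F u}) \<le> (1 - p) ^ N * card U"
    using greedy_cover[of "Pow {..<d}" U p R N] p by auto
  have nonneg: "0 \<le> 2 ^ m * real m * ln (2 * real d)"
    using assms by simp
  have N: "2 ^ m * real m * ln (2 * real d) < real N"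
    "real N \<le> 2 ^ m * real m * ln (2 * real d) + 2"
    using nonneg unfolding N_def by linarith+
  have "(1 - p) ^ N \<le> exp (- p) ^ N"
    using p exp_ge_add_one_self[of "- p"] by (intro power_mono) auto
  also have "\<dots> = exp (- (p * real N))"
    using exp_of_nat_mult[of N "- p"] by (simp add: mult.commute)
  also have "\<dots> < exp (- (real m * ln (2 * real d)))"
    using N(1) by (simp add: p_def field_simps)
  also have "\<dots> = 1 / (2 * real d) ^ m"
    using assms by (simp add: exp_minus exp_of_nat_mult field_simps)
  finally have "(1 - p) ^ N * (2 * real d) ^ m < 1"
    using assms by (simp add: field_simps)
  moreover have "real (card U) \<le> (2 * real d) ^ m"
    using of_nat_mono[OF card_traces_le[of d m]] unfolding U_def by simp
  then have "(1 - p) ^ N * card U \<le> (1 - p) ^ N * (2 * real d) ^ m"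
    using p by (intro mult_left_mono) auto
  ultimately have "card {u \<in> U. \<forall>F\<in>\<F>. \<not> R F u} = 0"
    using \<F>(3) by linarith
  then have "{u \<in> U. \<forall>F\<in>\<F>. \<not> R F u} = {}"
    using \<open>finite U\<close> by simp
  then have "hits_all_traces m {..<d} \<F>"
    unfolding hits_all_traces_def U_def R_def by blast
  then show ?thesis
    using \<F> N(2) by (intro exI[of _ \<F>]) auto
qed

section \<open>The bound on the size of shattering families\<close>

lemma f_min_le:
  assumes "k > 0" "t \<le> 2 ^ m" "m = nat \<lceil>log 2 (real k)\<rceil>" "n < 2 ^ d" "d > 0"
  shows "real (f_min k n t) \<le> 2 ^ m * real m * ln (2 * real d) + 2"
proof -
  obtain \<F> where \<F>: "\<F> \<subseteq> Pow {..<d}" "hits_all_traces m {..<d} \<F>"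
    "real (card \<F>) \<le> 2 ^ m * real m * ln (2 * real d) + 2"
    using exists_small_universal_family[OF assms(5)] by blast
  have fin: "finite \<F>"
    using \<F>(1) by (rule finite_subset) simp
  have "\<forall>F\<in>\<F>. \<exists>a :: nat. \<forall>i. bit a i \<longleftrightarrow> i \<in> F"
    using \<F>(1) exists_bits_eq by (meson PowD finite_lessThan finite_subset subsetD)
  then obtain code :: "nat set \<Rightarrow> nat" where code: "\<And>F i. F \<in> \<F> \<Longrightarrow> bit (code F) i \<longleftrightarrow> i \<in> F"
    by metis
  define P where "P = (\<lambda>F. flip_order {1..n} (code F)) ` \<F>"
  have "t_shatters t P X" if X: "X \<subseteq> {1..n}" "card X = k" for X
  proof -
    have Xd: "X \<subseteq> {..<2 ^ d}"
      using X assms(4) by fastforce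
    have "real k \<le> 2 ^ card (split_levels X)"
      using card_le_power_split_levels[OF Xd] X(2) by (metis of_nat_le_iff of_nat_numeral of_nat_power)
    then have "log 2 (real k) \<le> real (card (split_levels X))"
      using assms(1) by (simp add: log_le_iff powr_realpow)
    then have "m \<le> card (split_levels X)"
      unfolding assms(3) by (simp add: ceiling_le_iff nat_le_iff)
    then have "2 ^ m \<le> card ((\<lambda>F. flip_order X (code F)) ` \<F>)"
      using flip_orders_of_universal_family[OF Xd _ \<F>(2) fin code] by blast
    moreover have "induced X ` P = (\<lambda>F. flip_order X (code F)) ` \<F>"
      using X by (simp add: P_def image_image induced_flip_order)
    ultimately show ?thesis
      using assms(2) by (simp add: t_shatters_def)
  qed
  then have "shattering_family k n t P"
    by (auto simp: shattering_family_def P_def flip_order_in_perms_of)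
  then have "f_min k n t \<le> card P"
    unfolding f_min_def by (intro Least_le) blast
  also have "card P \<le> card \<F>"
    unfolding P_def using fin by (rule card_image_le)
  finally show ?thesis
    using \<F>(3) by linarith
qed

theorem theorem1p6:
  fixes k t :: nat
  assumes "k \<ge> 3" and "1 \<le> t" and "t \<le> 2 ^ nat \<lceil>log 2 (real k)\<rceil>"
  shows "(\<lambda>n. real (f_min k n t)) \<in> O(\<lambda>n. ln (ln (real n)))"
proof -
  define m where "m = nat \<lceil>log 2 (real k)\<rceil>"
  define c where "c = 2 ^ m * real m"
  \<comment> \<open>The numbers up to \<open>n\<close>, including \<open>n\<close> itself, have to fit into \<open>d\<close> bits; hence \<open>n + 1\<close>.\<close>
  have bound: "real (f_min k n t) \<le> c * ln (2 * (log 2 (real n + 1) + 1)) + 2" if "n \<ge> 1" for n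
  proof -
    define d where "d = nat \<lceil>log 2 (real n + 1)\<rceil>"
    have pos: "0 < log 2 (real n + 1)"
      using that by simp
    then have d: "d > 0" "log 2 (real n + 1) \<le> real d" "real d \<le> log 2 (real n + 1) + 1"
      unfolding d_def by linarith+
    have "real n + 1 \<le> 2 ^ d"
      using d(2) by (simp add: log_le_iff powr_realpow)
    then have "n < 2 ^ d"
      by (metis of_nat_less_iff of_nat_numeral of_nat_power less_add_one less_le_trans)
    then have "real (f_min k n t) \<le> c * ln (2 * real d) + 2"
      using f_min_le[OF _ assms(3)[folded m_def] m_def _ d(1)] assms(1) by (simp add: c_def)
    also have "c * ln (2 * real d) \<le> c * ln (2 * (log 2 (real n + 1) + 1))"
      using d by (intro mult_left_mono) (auto simp: c_def)
    finally show ?thesis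
      by simp
  qed
  have "(\<lambda>n. real (f_min k n t)) \<in> O(\<lambda>n. c * ln (2 * (log 2 (real n + 1) + 1)) + 2)"
    using bound by (intro landau_o.big_mono eventually_mono[OF eventually_ge_at_top[of 1]]) force
  also have "(\<lambda>n. c * ln (2 * (log 2 (real n + 1) + 1)) + 2) \<in> O(\<lambda>n. ln (ln (real n)))"
  proof (rule sum_in_bigo)
    have "(\<lambda>n. ln (2 * (log 2 (real n + 1) + 1))) \<in> O(\<lambda>n. ln (ln (real n)))"
      by real_asymp
    then show "(\<lambda>n. c * ln (2 * (log 2 (real n + 1) + 1))) \<in> O(\<lambda>n. ln (ln (real n)))"
      by simp
    show "(\<lambda>_ :: nat. 2 :: real) \<in> O(\<lambda>n. ln (ln (real n)))"
      by real_asymp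
  qed
  finally show ?thesis .
qed

end
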